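(* Let $g:X\to[0,1]$ be a $g$-function on $X=A^{-\mathbb N}$ ($A$ a finite alphabet) and let $\mathcal D\subset X$ be its set of discontinuity points. Assume that at least one of the following two sets of hypotheses holds. (1) There exists $\varepsilon>0$ such that $\inf_X g=\varepsilon$ and $\overline{gr}(\mathcal D)<[1-(|A|-1)\varepsilon]^{-1}$. (2) There exist $N\in\mathbb N$ and $\varepsilon>0$ such that $\inf_{\mathcal E_N}g=\varepsilon$, $\overline{gr}(\mathcal D)<[1-(|A|-1)\varepsilon]^{-1}$, and $T\mathcal D\subset\mathcal D$. Then there exists at least one $g$-measure $\mu$, and $\mu$ is carried by $X\setminus\mathcal D$, i.e. $\mu(\mathcal D)=0$.
   Context: $A$ is a finite set, $|A|$ its cardinality, $\mathbb N=\{0,1,2,\dots\}$. $X=A^{-\mathbb N}$ is the set of sequences $x=(x_{-i})_{i\in\mathbb N}=\dots x_{-1}x_0$, with the product of the discrete topologies and the $\sigma$-algebra $\mathcal F$ generated by the coordinates. For $x\in X$, $a\in A$, $xa\in X$ is the sequence $\dots x_{-1}x_0a$ (last coordinate $a$). $T:X\to X$ is the shift $(x_n)_{n\le0}\mapsto(x_{n-1})_{n\le 0}$, so $T(xa)=x$. A $g$-function is an $\mathcal F$-measurable $g:X\to[0,1]$ with $\sum_{a\in A}g(xa)=1$ for all $x\in X$. A $g$-measure is a Borel probability measure $\mu$ on $X$ that is $T$-invariant and such that for $\mu$-a.e. $x$ and every $a\in A$, $\mathbb E_\mu(\mathbf 1_{\{x_0=a\}}\mid T^{-1}\mathcal F)(x)=g(T(x)a)$.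 $\mathcal D$ is the set of points of $X$ at which $g$ is not continuous (for the product topology). Cylinders: $C_n(x)=\{w\in X: w_{-n+1}^0=x_{-n+1}^0\}$, where $x_{-n+1}^0=(x_{-n+1},\dots,x_0)$; $\mathcal C_n(\mathcal D)=\bigcup_{x\in\mathcal D}C_n(x)$. For $n\in\mathbb N$, $\mathcal E_n=T^{-1}\big(T(\mathcal C_{n+1}(\mathcal D))\big)$; i.e. $\mathcal E_n$ is the set of points $y x_{-n}\cdots x_{-1}a$ with $a\in A$, $x\in\mathcal D$, $y\in X$. $\mathcal D^n=\{x_{-n+1}^0: x\in\mathcal D\}\subset A^n$, and the upper exponential growth rate of $\mathcal D$ is $\overline{gr}(\mathcal D)=\limsup_{n\to\infty}|\mathcal D^n|^{1/n}$. *)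

theory Defs
  imports "HOL-Probability.Probability"
begin

text \<open>
  The alphabet is a finite type \<open>'a\<close>. A left-infinite sequence \<open>\<dots> x\<^sub>-\<^sub>2 x\<^sub>-\<^sub>1 x\<^sub>0\<close> is the function
  \<open>x :: nat \<Rightarrow> 'a\<close> whose value at \<open>i\<close> is the letter with index \<open>-i\<close>. So \<open>x 0\<close> is the
  last letter.
\<close>

type_synonym 'a seq = "nat \<Rightarrow> 'a"

definition seq_topology :: "'a::finite seq topology" where
  "seq_topology = product_topology (\<lambda>_. discrete_topology UNIV) UNIV"

text \<open>The product \<open>\<sigma>\<close>-algebra generated by the coordinates. As the alphabet is finite, it is
  also the Borel \<open>\<sigma>\<close>-algebra of \<open>seq_topology\<close>.\<close>

definition seq_algebra :: "'a::finite seq measure" where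
  "seq_algebra = Pi\<^sub>M UNIV (\<lambda>_. count_space UNIV)"

definition snoc :: "'a seq \<Rightarrow> 'a \<Rightarrow> 'a seq" where
  "snoc x a = case_nat a x"

definition seq_shift :: "'a seq \<Rightarrow> 'a seq" where
  "seq_shift x = (\<lambda>i. x (Suc i))"

definition g_function :: "('a::finite seq \<Rightarrow> real) \<Rightarrow> bool" where
  "g_function g \<longleftrightarrow>
     g \<in> borel_measurable seq_algebra \<and>
     range g \<subseteq> {0..1} \<and>
     (\<forall>x. (\<Sum>a\<in>UNIV. g (snoc x a)) = 1)"

definition g_measure :: "('a::finite seq \<Rightarrow> real) \<Rightarrow> 'a seq measure \<Rightarrow> bool" where
  "g_measure g \<mu> \<longleftrightarrow>
     prob_space \<mu> \<and>
     sets \<mu> = sets seq_algebra \<and>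
     distr \<mu> seq_algebra seq_shift = \<mu> \<and>
     (AE x in \<mu>. \<forall>a.
        real_cond_exp \<mu> (vimage_algebra UNIV seq_shift seq_algebra) (indicator {y. y 0 = a}) x
          = g (snoc (seq_shift x) a))"

definition disc_set :: "('a::finite seq \<Rightarrow> real) \<Rightarrow> 'a seq set" where
  "disc_set g = {x. \<not> topcontinuous_at seq_topology euclideanreal g x}"

definition cyl :: "nat \<Rightarrow> 'a seq \<Rightarrow> 'a seq set" where
  "cyl n x = {w. \<forall>i<n. w i = x i}"

definition cyls :: "nat \<Rightarrow> 'a seq set \<Rightarrow> 'a seq set" where
  "cyls n D = (\<Union>x\<in>D. cyl n x)"

definition ext_set :: "'a seq set \<Rightarrow> nat \<Rightarrow> 'a seq set" where
  "ext_set D n = seq_shift -` (seq_shift ` cyls (Suc n) D)"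

text \<open>The words \<open>x\<^sub>-\<^sub>n\<^sub>+\<^sub>1 \<dots> x\<^sub>0\<close>, read from left to right, for \<open>x \<in> D\<close>.\<close>

definition words :: "'a seq set \<Rightarrow> nat \<Rightarrow> 'a list set" where
  "words D n = (\<lambda>x. rev (map x [0..<n])) ` D"

definition upper_growth_rate :: "'a::finite seq set \<Rightarrow> ereal" where
  "upper_growth_rate D = limsup (\<lambda>n. ereal (root n (real (card (words D n)))))"

end

theory Submission
  imports Defs "HOL-Complex_Analysis.Great_Picard"
begin

text \<open>
  Let \<open>P f y = (\<Sum>a. g (y a) f (y a))\<close> be the transfer operator. A limit \<open>\<mu>\<close>, on the cylinder algebra, of
  the averages \<open>f \<mapsto> (1/k) (\<Sum>j<k. P\<^sup>j f x\<^sub>0)\<close> exists by a diagonal argument and extends to a measure by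
  compactness. Since \<open>P f\<close> for a cylinder indicator \<open>f\<close> is continuous off \<open>T D\<close>, the measure \<open>\<mu>\<close> is a
  \<open>g\<close>-measure as soon as the \<open>n\<close>-cylinder neighbourhoods of \<open>T D\<close> have measure tending to \<open>0\<close>. Both sets
  of hypotheses give a bound \<open>g \<le> r := 1 - (|A| - 1) \<epsilon>\<close> near the orbits of points of \<open>D\<close>, hence
  \<open>\<mu> (C\<^sub>n x) \<le> r\<^sup>n\<^sup>-\<^sup>N\<close> for \<open>x\<close> in \<open>D\<close> or \<open>T D\<close>; summing over the words of length \<open>n\<close>, the growth
  condition makes the neighbourhoods of \<open>D\<close> and of \<open>T D\<close> small.
\<close>

section \<open>Cylinders and locally constant functions\<close>

lemma cyl_self [simp]: "x \<in> cyl n x"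
  by (simp add: cyl_def)

lemma cyl_sym: "y \<in> cyl n x \<Longrightarrow> x \<in> cyl n y"
  by (simp add: cyl_def)

lemma cyl_trans: "y \<in> cyl n x \<Longrightarrow> z \<in> cyl n y \<Longrightarrow> z \<in> cyl n x"
  by (simp add: cyl_def)

lemma cyl_antimono: "m \<le> n \<Longrightarrow> cyl n x \<subseteq> cyl m x"
  by (auto simp: cyl_def)

lemma subset_cyls: "E \<subseteq> cyls n E"
  by (auto simp: cyls_def cyl_def)

lemma map_upt_eq_iff: "map y [0..<n] = map x [0..<n] \<longleftrightarrow> y \<in> cyl n x"
  by (auto simp: cyl_def)

lemma nth_map_in_cyl: "(!) (map x [0..<n]) \<in> cyl n x"
  by (auto simp: cyl_def)

lemma finite_words_length: "finite {w :: 'a::finite list. length w = n}"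
  using finite_lists_length_eq[of "UNIV :: 'a set" n] by simp

lemma seq_shift_snoc [simp]: "seq_shift (snoc x a) = x"
  by (simp add: seq_shift_def snoc_def)

lemma snoc_0 [simp]: "snoc x a 0 = a"
  by (simp add: snoc_def)

lemma snoc_Suc [simp]: "snoc x a (Suc i) = x i"
  by (simp add: snoc_def)

lemma snoc_seq_shift [simp]: "snoc (seq_shift x) (x 0) = x"
  by (rule ext) (simp add: snoc_def seq_shift_def split: nat.split)

lemma snoc_in_cyl_Suc: "snoc y a \<in> cyl (Suc n) x \<longleftrightarrow> a = x 0 \<and> y \<in> cyl n (seq_shift x)"
  by (auto simp: cyl_def seq_shift_def less_Suc_eq_0_disj)

text \<open>The codomain is left open so that one notion serves real functions and, through
  membership predicates, sets.\<close>

definition depends :: "nat \<Rightarrow> ('a seq \<Rightarrow> 'b) \<Rightarrow> bool" where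
  "depends n h \<longleftrightarrow> (\<forall>x. \<forall>y\<in>cyl n x. h y = h x)"

lemma depends_mono: "depends m h \<Longrightarrow> m \<le> n \<Longrightarrow> depends n h"
  unfolding depends_def using cyl_antimono by blast

lemma dependsD: "depends n h \<Longrightarrow> y \<in> cyl n x \<Longrightarrow> h y = h x"
  by (auto simp: depends_def)

text \<open>For a finite alphabet these are the clopen sets of the sequence space.\<close>

definition cyl_algebra :: "'a seq set set" where
  "cyl_algebra = {C. \<exists>n. depends n (\<lambda>x. x \<in> C)}"

lemma cyl_algebraI: "depends n (\<lambda>x. x \<in> C) \<Longrightarrow> C \<in> cyl_algebra"
  by (auto simp: cyl_algebra_def)

lemma cyl_algebraE:
  assumes "C \<in> cyl_algebra"
  obtains n where "depends n (\<lambda>x. x \<in> C)"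
  using assms by (auto simp: cyl_algebra_def)

text \<open>Both sets depend on the last \<open>max m n\<close> letters, hence so does every Boolean
  combination of them.\<close>

lemma cyl_algebra_comb:
  assumes "A \<in> cyl_algebra" "B \<in> cyl_algebra"
  shows "{x. P (x \<in> A) (x \<in> B)} \<in> cyl_algebra"
proof -
  obtain m n where "depends m (\<lambda>x. x \<in> A)" "depends n (\<lambda>x. x \<in> B)"
    using assms by (auto simp: cyl_algebra_def)
  then have "depends (max m n) (\<lambda>x. x \<in> A)" "depends (max m n) (\<lambda>x. x \<in> B)"
    by (auto intro: depends_mono)
  then have "depends (max m n) (\<lambda>x. x \<in> {x. P (x \<in> A) (x \<in> B)})"
    unfolding depends_def by auto
  then show ?thesis by (rule cyl_algebraI)
qed

lemma cyl_algebra_Un: "A \<in> cyl_algebra \<Longrightarrow> B \<in> cyl_algebra \<Longrightarrow> A \<union> B \<in> cyl_algebra"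
  using cyl_algebra_comb[of A B "(\<or>)"] by (simp add: Un_def)

lemma cyl_algebra_Int: "A \<in> cyl_algebra \<Longrightarrow> B \<in> cyl_algebra \<Longrightarrow> A \<inter> B \<in> cyl_algebra"
  using cyl_algebra_comb[of A B "(\<and>)"] by (simp add: Int_def)

lemma cyl_algebra_Diff: "A \<in> cyl_algebra \<Longrightarrow> B \<in> cyl_algebra \<Longrightarrow> A - B \<in> cyl_algebra"
  using cyl_algebra_comb[of A B "\<lambda>p q. p \<and> \<not> q"] by (simp add: set_diff_eq)

lemma cyl_algebra_empty: "{} \<in> cyl_algebra"
  by (rule cyl_algebraI[of 0]) (simp add: depends_def)

lemma cyl_algebra_UNIV: "UNIV \<in> cyl_algebra"
  by (rule cyl_algebraI[of 0]) (simp add: depends_def)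

text \<open>Sharing the last \<open>n\<close> letters is an equivalence relation, and
  \<open>cyls n E\<close> is a union of its classes.\<close>

lemma depends_cyls: "depends n (\<lambda>x. x \<in> cyls n E)"
  unfolding depends_def cyls_def by (auto intro: cyl_trans cyl_sym)

lemma cyls_in_cyl_algebra: "cyls n E \<in> cyl_algebra"
  by (rule cyl_algebraI[OF depends_cyls])

lemma cyl_in_cyl_algebra: "cyl n x \<in> cyl_algebra"
  using cyls_in_cyl_algebra[of n "{x}"] by (simp add: cyls_def)

lemma word_set_in_cyl_algebra: "{x. map x [0..<n] = w} \<in> cyl_algebra"
  by (rule cyl_algebraI[of n]) (auto simp: depends_def cyl_def cong: map_cong)

lemma shift_vimage_in_cyl_algebra:
  assumes "C \<in> cyl_algebra"
  shows "seq_shift -` C \<in> cyl_algebra"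
proof -
  obtain n where n: "depends n (\<lambda>x. x \<in> C)" by (rule cyl_algebraE[OF assms])
  have "seq_shift y \<in> cyl n (seq_shift x)" if "y \<in> cyl (Suc n) x" for x y :: "'a seq"
    using that by (auto simp: cyl_def seq_shift_def)
  with n have "depends (Suc n) (\<lambda>x. x \<in> seq_shift -` C)"
    unfolding depends_def by auto
  then show ?thesis by (rule cyl_algebraI)
qed

lemma first_letter_in_cyl_algebra: "{x. x 0 = a} \<in> cyl_algebra"
  by (rule cyl_algebraI[of 1]) (auto simp: depends_def cyl_def)

text \<open>The sequence \<open>(!) w\<close> has junk letters from position \<open>n\<close> on, which \<open>h\<close> ignores.\<close>

lemma depends_eq_sum:
  fixes h :: "'a::finite seq \<Rightarrow> real"
  assumes "depends n h"
  shows "h x = (\<Sum>w | length w = n. h ((!) w) * indicator {y. map y [0..<n] = w} x)"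
proof -
  have "(\<Sum>w | length w = n. h ((!) w) * indicator {y. map y [0..<n] = w} x)
      = (\<Sum>w\<in>{map x [0..<n]}. h ((!) w) * indicator {y. map y [0..<n] = w} x)"
    by (rule sum.mono_neutral_right) (auto simp: finite_words_length indicator_def)
  also have "\<dots> = h ((!) (map x [0..<n]))" by simp
  also have "\<dots> = h x" using assms nth_map_in_cyl by (rule dependsD)
  finally show ?thesis by simp
qed

section \<open>The topology and the \<open>\<sigma>\<close>-algebra\<close>

lemma topspace_seq_topology [simp]: "topspace seq_topology = UNIV"
  by (simp add: seq_topology_def)

text \<open>A basic open box restricts finitely many coordinates, so it contains every cylinder
  around one of its points that is long enough to fix them all; conversely a cylinder is itself such
  a box.\<close>

lemma openin_seq_topology: "openin seq_topology C \<longleftrightarrow> (\<forall>x\<in>C. \<exists>n. cyl n x \<subseteq> C)"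
proof
  assume C: "openin seq_topology C"
  show "\<forall>x\<in>C. \<exists>n. cyl n x \<subseteq> C"
  proof
    fix x assume "x \<in> C"
    with C obtain U where U: "finite {i. U i \<noteq> UNIV}" "x \<in> Pi\<^sub>E UNIV U" "Pi\<^sub>E UNIV U \<subseteq> C"
      unfolding seq_topology_def openin_product_topology_alt by (auto)
    obtain n where n: "\<And>i. U i \<noteq> UNIV \<Longrightarrow> i < n"
      using U(1) unfolding finite_nat_set_iff_bounded by blast
    have "cyl n x \<subseteq> Pi\<^sub>E UNIV U"
    proof
      fix y assume y: "y \<in> cyl n x"
      have "y i \<in> U i" for i
        using U(2) n[of i] y by (cases "U i = UNIV") (auto simp: cyl_def PiE_def Pi_def)
      then show "y \<in> Pi\<^sub>E UNIV U" by auto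
    qed
    then show "\<exists>n. cyl n x \<subseteq> C" using U(3) by blast
  qed
next
  assume C: "\<forall>x\<in>C. \<exists>n. cyl n x \<subseteq> C"
  show "openin seq_topology C"
    unfolding seq_topology_def openin_product_topology_alt
  proof
    fix x assume "x \<in> C"
    with C obtain n where n: "cyl n x \<subseteq> C" by blast
    let ?U = "\<lambda>i. if i < n then {x i} else UNIV"
    have "Pi\<^sub>E UNIV ?U \<subseteq> cyl n x"
      by (auto simp: cyl_def PiE_def Pi_def split: if_splits)
    moreover have "finite {i. ?U i \<noteq> UNIV}"
      by (rule finite_subset[of _ "{..<n}"]) auto
    ultimately show "\<exists>U. finite {i \<in> UNIV. U i \<noteq> topspace (discrete_topology UNIV)} \<and>
        (\<forall>i\<in>UNIV. openin (discrete_topology UNIV) (U i)) \<and> x \<in> Pi\<^sub>E UNIV U \<and> Pi\<^sub>E UNIV U \<subseteq> C"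
      using n by (intro exI[of _ ?U]) auto
  qed
qed

lemma closedin_cyl_algebra:
  assumes "C \<in> cyl_algebra"
  shows "closedin seq_topology C"
proof -
  obtain n where "depends n (\<lambda>x. x \<in> C)" by (rule cyl_algebraE[OF assms])
  then have "openin seq_topology (- C)"
    unfolding openin_seq_topology depends_def by blast
  then show ?thesis by (simp add: closedin_def Compl_eq_Diff_UNIV)
qed

lemma compact_seq_topology: "compact_space (seq_topology :: 'a::finite seq topology)"
  unfolding seq_topology_def
  by (simp add: compact_space_product_topology compact_space_discrete_topology)

text \<open>Compactness, for nested closed sets. It serves twice: for countable additivity of the
  limit measure and for uniform continuity off a cylinder neighbourhood.\<close>

lemma cyl_algebra_nest:
  fixes C :: "nat \<Rightarrow> 'a::finite seq set"
  assumes "\<And>n. C n \<in> cyl_algebra" "decseq C" "\<And>n. C n \<noteq> {}"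
  shows "(\<Inter>n. C n) \<noteq> {}"
  using compact_space_imp_nest[OF compact_seq_topology closedin_cyl_algebra] assms by blast

lemma eventually_nhdsin_seq:
  "eventually P (nhdsin seq_topology x) \<longleftrightarrow> (\<exists>n. \<forall>z\<in>cyl n x. P z)"
proof
  assume "eventually P (nhdsin seq_topology x)"
  then show "\<exists>n. \<forall>z\<in>cyl n x. P z"
    by (auto simp: eventually_nhdsin openin_seq_topology) blast
next
  assume "\<exists>n. \<forall>z\<in>cyl n x. P z"
  then obtain n where n: "\<forall>z\<in>cyl n x. P z" by blast
  have "openin seq_topology (cyl n x)"
    unfolding openin_seq_topology by (auto intro!: exI[of _ n] intro: cyl_trans)
  with n show "eventually P (nhdsin seq_topology x)"
    by (auto simp: eventually_nhdsin)
qed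

lemma disc_set_iff:
  "x \<in> disc_set g \<longleftrightarrow> \<not> (g \<longlongrightarrow> g x) (nhdsin seq_topology x)"
proof -
  have "topcontinuous_at seq_topology euclideanreal g x \<longleftrightarrow> (g \<longlongrightarrow> g x) (nhdsin seq_topology x)"
    unfolding topcontinuous_at_def tendsto_def eventually_nhdsin by auto
  then show ?thesis by (simp add: disc_set_def)
qed

lemma tendsto_depends:
  fixes h :: "'a::finite seq \<Rightarrow> real"
  assumes "depends n h"
  shows "(h \<longlongrightarrow> h x) (nhdsin seq_topology x)"
proof (rule tendsto_eventually)
  show "eventually (\<lambda>z. h z = h x) (nhdsin seq_topology x)"
    unfolding eventually_nhdsin_seq using dependsD[OF assms] by blast
qed

text \<open>Continuity of appending a letter carries continuity of \<open>g\<close> at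
  \<open>snoc x a\<close> over to the map \<open>z \<mapsto> g (snoc z a)\<close> at
  \<open>x\<close>.\<close>

lemma filterlim_snoc:
  "filterlim (\<lambda>z. snoc z a) (nhdsin seq_topology (snoc x a)) (nhdsin seq_topology x)"
  unfolding filterlim_iff eventually_nhdsin_seq
proof safe
  fix P n assume P: "\<forall>z\<in>cyl n (snoc x a). P z"
  have "snoc z a \<in> cyl n (snoc x a)" if "z \<in> cyl n x" for z
    using that by (auto simp: cyl_def snoc_def split: nat.split)
  with P show "\<exists>n. \<forall>z\<in>cyl n x. P (snoc z a)" by blast
qed

section \<open>Measurability of cylinder sets and of the discontinuity set\<close>

lemma space_seq_algebra [simp]: "space seq_algebra = UNIV"
  by (simp add: seq_algebra_def space_PiM)

lemma coordinate_measurable [measurable]: "(\<lambda>x. x i) \<in> measurable seq_algebra (count_space UNIV)"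
  unfolding seq_algebra_def by simp

lemma sets_seq_algebra: "sets (seq_algebra :: 'a::finite seq measure) = sigma_sets UNIV cyl_algebra"
proof
  have "sets (Pi\<^sub>M UNIV (\<lambda>_. count_space (UNIV :: 'a set))) \<subseteq> sets (sigma UNIV (cyl_algebra :: 'a seq set set))"
  proof (rule sets_PiM_in_sets)
    fix i :: nat and A :: "'a set"
    have "{x :: 'a seq. x i \<in> A} \<in> cyl_algebra"
      by (rule cyl_algebraI[of "Suc i"]) (auto simp: depends_def cyl_def)
    then show "{x \<in> space (sigma UNIV (cyl_algebra :: 'a seq set set)). x i \<in> A} \<in> sets (sigma UNIV cyl_algebra)"
      by auto
  qed (simp add: space_measure_of_conv)
  then show "sets (seq_algebra :: 'a seq measure) \<subseteq> sigma_sets UNIV cyl_algebra"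
    by (simp add: seq_algebra_def)
next
  have "C \<in> sets seq_algebra" if C: "C \<in> cyl_algebra" for C :: "'a seq set"
  proof -
    obtain n where n: "depends n (\<lambda>x. x \<in> C)" by (rule cyl_algebraE[OF C])
    \<comment> \<open>A set depending on \<open>n\<close> letters is a finite union over words, each
      word giving finitely many coordinate conditions.\<close>
    have "C = (\<Union>w\<in>{w. length w = n \<and> (!) w \<in> C}. {x. \<forall>i<n. x i = w ! i})"
    proof safe
      fix x assume "x \<in> C"
      moreover have "(!) (map x [0..<n]) \<in> cyl n x" by (rule nth_map_in_cyl)
      ultimately show "x \<in> (\<Union>w\<in>{w. length w = n \<and> (!) w \<in> C}. {x. \<forall>i<n. x i = w ! i})"
        using dependsD[OF n] by (intro UN_I[of "map x [0..<n]"]) auto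
    next
      fix x w assume "(!) w \<in> C" "\<forall>i<length w. x i = w ! i" "n = length w"
      then show "x \<in> C" using dependsD[OF n, of x "(!) w"] by (simp add: cyl_def)
    qed
    moreover have "finite {w :: 'a list. length w = n \<and> (!) w \<in> C}"
      by (rule finite_subset[OF _ finite_words_length[of n]]) auto
    moreover have "{x. \<forall>i<n. x i = w ! i} \<in> sets (seq_algebra :: 'a seq measure)" for w
    proof -
      have "{x \<in> space (seq_algebra :: 'a seq measure). \<forall>i\<in>{..<n}. x i = w ! i} \<in> sets seq_algebra"
        by measurable
      then show ?thesis by (simp add: lessThan_def)
    qed
    ultimately show ?thesis by (metis (no_types, lifting) sets.finite_UN)
  qed
  then show "sigma_sets UNIV cyl_algebra \<subseteq> sets (seq_algebra :: 'a seq measure)"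
    using sets.sigma_sets_subset[of cyl_algebra "seq_algebra :: 'a seq measure"] by auto
qed

lemma cyl_algebra_sets: "C \<in> cyl_algebra \<Longrightarrow> C \<in> sets (seq_algebra :: 'a::finite seq measure)"
  by (simp add: sets_seq_algebra)

lemma Int_stable_cyl_algebra: "Int_stable cyl_algebra"
  by (auto simp: Int_stable_def cyl_algebra_Int)

text \<open>Uniqueness by the \<pi>-\<lambda> argument: the cylinder algebra is closed under
  intersection, generates, and contains the whole space.\<close>

lemma seq_measure_eqI:
  fixes \<mu> \<nu> :: "'a::finite seq measure"
  assumes "sets \<mu> = sets seq_algebra" "sets \<nu> = sets seq_algebra" "finite_measure \<mu>"
    and "\<And>C. C \<in> cyl_algebra \<Longrightarrow> emeasure \<mu> C = emeasure \<nu> C"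
  shows "\<mu> = \<nu>"
  using assms cyl_algebra_UNIV
  by (intro measure_eqI_generator_eq[OF Int_stable_cyl_algebra, of UNIV \<mu> \<nu> "\<lambda>_. UNIV"])
     (auto simp: sets_seq_algebra finite_measure.emeasure_eq_measure)

lemma seq_shift_measurable [measurable]: "seq_shift \<in> measurable seq_algebra seq_algebra"
  unfolding seq_shift_def seq_algebra_def by (rule measurable_PiM_single') auto

lemma snoc_measurable [measurable]: "(\<lambda>x. snoc x a) \<in> measurable seq_algebra seq_algebra"
proof -
  have "(\<lambda>x. snoc x a i) \<in> measurable (Pi\<^sub>M UNIV (\<lambda>_. count_space UNIV)) (count_space UNIV)" for i
    by (cases i) auto
  then show ?thesis unfolding seq_algebra_def by (intro measurable_PiM_single') auto
qed

lemma depends_measurable: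
  fixes h :: "'a::finite seq \<Rightarrow> real"
  assumes "depends n h"
  shows "h \<in> borel_measurable seq_algebra"
proof -
  have "h = (\<lambda>x. \<Sum>w | length w = n. h ((!) w) * indicator {y. map y [0..<n] = w} x)"
    using depends_eq_sum[OF assms] by blast
  moreover have "(\<lambda>x. \<Sum>w | length w = n. h ((!) w) * indicator {y. map y [0..<n] = w} x)
      \<in> borel_measurable seq_algebra"
    by (intro borel_measurable_sum borel_measurable_times borel_measurable_const
        borel_measurable_indicator cyl_algebra_sets word_set_in_cyl_algebra)
  ultimately show ?thesis by metis
qed

text \<open>Continuity at \<open>x\<close> means that the oscillation of \<open>g\<close> on the
  cylinders around \<open>x\<close> tends to 0, which is a countable combination of cylinder
  sets.\<close>

lemma disc_set_measurable:
  fixes g :: "'a::finite seq \<Rightarrow> real"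
  shows "disc_set g \<in> sets seq_algebra"
proof -
  \<comment> \<open>Comparing two points of the cylinder, rather than one point with
    \<open>x\<close>, makes membership in \<open>S k n\<close> constant on
    \<open>n\<close>-cylinders.\<close>
  define S where "S k n = {x. \<forall>z\<in>cyl n x. \<forall>z'\<in>cyl n x. \<bar>g z - g z'\<bar> < inverse (real (Suc k))}" for k n
  have "x \<in> disc_set g \<longleftrightarrow> \<not> (\<forall>k. \<exists>n. x \<in> S k n)" for x
  proof -
    have "(\<forall>k. \<exists>n. x \<in> S k n) \<longleftrightarrow> (g \<longlongrightarrow> g x) (nhdsin seq_topology x)"
    proof
      assume S: "\<forall>k. \<exists>n. x \<in> S k n"
      show "(g \<longlongrightarrow> g x) (nhdsin seq_topology x)"
        unfolding tendsto_iff eventually_nhdsin_seq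
      proof (intro allI impI)
        fix e :: real assume "e > 0"
        then obtain k where k: "inverse (real (Suc k)) < e" using reals_Archimedean by blast
        from S obtain n where "x \<in> S k n" by blast
        then have "\<forall>z\<in>cyl n x. \<bar>g z - g x\<bar> < inverse (real (Suc k))"
          by (auto simp: S_def simp del: of_nat_Suc)
        with k show "\<exists>n. \<forall>z\<in>cyl n x. dist (g z) (g x) < e"
          unfolding dist_real_def by (meson less_trans)
      qed
    next
      assume lim: "(g \<longlongrightarrow> g x) (nhdsin seq_topology x)"
      show "\<forall>k. \<exists>n. x \<in> S k n"
      proof
        fix k
        have "inverse (real (Suc k)) / 2 > 0" by simp
        from tendstoD[OF lim this] obtain n
          where n: "\<forall>z\<in>cyl n x. dist (g z) (g x) < inverse (real (Suc k)) / 2"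
          unfolding eventually_nhdsin_seq by blast
        have "\<bar>g z - g z'\<bar> < inverse (real (Suc k))" if z: "z \<in> cyl n x" "z' \<in> cyl n x" for z z'
          using dist_triangle_half_l[OF bspec[OF n z(1)] bspec[OF n z(2)]]
          by (simp only: dist_real_def)
        then show "\<exists>n. x \<in> S k n" unfolding S_def by blast
      qed
    qed
    then show ?thesis by (simp add: disc_set_iff)
  qed
  then have eq: "disc_set g = (\<Union>k. \<Inter>n. UNIV - S k n)"
    by (intro set_eqI) simp
  have "S k n \<in> sets (seq_algebra :: 'a seq measure)" for k n
  proof (rule cyl_algebra_sets, rule cyl_algebraI)
    have "cyl n y = cyl n x" if "y \<in> cyl n x" for x y :: "'a seq"
      using that by (auto intro: cyl_trans cyl_sym)
    then show "depends n (\<lambda>x. x \<in> S k n)" unfolding depends_def S_def by simp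
  qed
  then have "UNIV - S k n \<in> sets (seq_algebra :: 'a seq measure)" for k n
    using sets.compl_sets[of "S k n" "seq_algebra :: 'a seq measure"] by simp
  then show ?thesis unfolding eq by (intro sets.countable_UN sets.countable_INT image_subsetI) blast+
qed

section \<open>Limits of means on the cylinder algebra\<close>

text \<open>Normalised positive linear functionals on all real functions. This covers both the
  powers of the transfer operator evaluated at a point and their averages.\<close>

locale mean_functional =
  fixes L :: "('b \<Rightarrow> real) \<Rightarrow> real"
  assumes add: "L (\<lambda>x. f x + h x) = L f + L h"
    and scale: "L (\<lambda>x. c * f x) = c * L f"
    and mono: "(\<And>x. f x \<le> h x) \<Longrightarrow> L f \<le> L h"
    and one: "L (\<lambda>_. 1) = 1"
begin

lemma const: "L (\<lambda>_. c) = c"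
  using scale[of c "\<lambda>_. 1"] one by simp

lemma sum: "finite I \<Longrightarrow> L (\<lambda>x. \<Sum>i\<in>I. f i x) = (\<Sum>i\<in>I. L (f i))"
  by (induction I rule: finite_induct) (auto simp: add const)

lemma nonneg: "(\<And>x. 0 \<le> f x) \<Longrightarrow> 0 \<le> L f"
  using mono[of "\<lambda>_. 0" f] const[of 0] by simp

lemma le_const: "(\<And>x. f x \<le> c) \<Longrightarrow> L f \<le> c"
  using mono[of f "\<lambda>_. c"] const[of c] by simp

lemma abs_diff_le:
  assumes "\<And>x. \<bar>f x - h x\<bar> \<le> u x"
  shows "\<bar>L f - L h\<bar> \<le> L u"
proof -
  have "L f \<le> L (\<lambda>x. h x + u x)" "L h \<le> L (\<lambda>x. f x + u x)"
    using assms by (auto intro!: mono simp: abs_le_iff algebra_simps)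
  then show ?thesis by (simp add: add)
qed

end

text \<open>A locally constant function is a finite combination of word indicators, so convergence
  need only be arranged on these.\<close>

lemma mean_functional_depends:
  fixes h :: "'a::finite seq \<Rightarrow> real"
  assumes "mean_functional L" "depends n h"
  shows "L h = (\<Sum>w | length w = n. h ((!) w) * L (indicator {y. map y [0..<n] = w}))"
proof -
  interpret mean_functional L by fact
  have "h = (\<lambda>x. \<Sum>w | length w = n. h ((!) w) * indicator {y. map y [0..<n] = w} x)"
    using depends_eq_sum[OF assms(2)] by blast
  then have "L h = L (\<lambda>x. \<Sum>w | length w = n. h ((!) w) * indicator {y. map y [0..<n] = w} x)"
    by (rule arg_cong)
  also have "\<dots> = (\<Sum>w | length w = n. L (\<lambda>x. h ((!) w) * indicator {y. map y [0..<n] = w} x))"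
    by (rule sum[OF finite_words_length])
  finally show ?thesis by (simp only: scale)
qed

section \<open>Construction of the limit measure\<close>

lemma cyl_algebra_measure_exists:
  fixes m :: "'a::finite seq set \<Rightarrow> real"
  assumes nonneg: "\<And>C. C \<in> cyl_algebra \<Longrightarrow> 0 \<le> m C"
    and add: "\<And>C D. C \<in> cyl_algebra \<Longrightarrow> D \<in> cyl_algebra \<Longrightarrow> C \<inter> D = {} \<Longrightarrow> m (C \<union> D) = m C + m D"
    and one: "m UNIV = 1"
  shows "\<exists>\<mu>. prob_space \<mu> \<and> sets \<mu> = sets seq_algebra \<and> (\<forall>C\<in>cyl_algebra. measure \<mu> C = m C)"
proof -
  interpret ring_of_sets "UNIV :: 'a seq set" cyl_algebra
    by (auto simp: ring_of_sets_iff cyl_algebra_empty cyl_algebra_Un cyl_algebra_Diff)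
  have empty: "m {} = 0" using add[of "{}" "{}"] cyl_algebra_empty by simp
  have "\<exists>\<nu>. (\<forall>s\<in>cyl_algebra. \<nu> s = ennreal (m s)) \<and> measure_space UNIV (sigma_sets UNIV cyl_algebra) \<nu>"
  proof (rule caratheodory_empty_continuous)
    show "positive cyl_algebra (\<lambda>s. ennreal (m s))"
      by (simp add: positive_def empty)
    show "additive cyl_algebra (\<lambda>s. ennreal (m s))"
      by (auto simp: additive_def add nonneg ennreal_plus)
    fix A :: "nat \<Rightarrow> 'a seq set"
    \<comment> \<open>Continuity at the empty set is the only point beyond finite additivity: by
      compactness such a sequence is eventually empty.\<close>
    assume A: "range A \<subseteq> cyl_algebra" "decseq A" "(\<Inter>i. A i) = {}"
    then obtain i where "A i = {}"
      using cyl_algebra_nest[of A] by blast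
    with A(2) have "A j = {}" if "j \<ge> i" for j using that by (auto simp: decseq_def)
    then have "eventually (\<lambda>j. ennreal (m (A j)) = 0) sequentially"
      by (intro eventually_sequentiallyI[of i]) (simp add: empty)
    then show "(\<lambda>i. ennreal (m (A i))) \<longlonglongrightarrow> 0" by (rule tendsto_eventually)
  qed auto
  then obtain \<nu> where \<nu>: "\<And>C. C \<in> cyl_algebra \<Longrightarrow> \<nu> C = ennreal (m C)"
    and ms: "measure_space UNIV (sigma_sets UNIV (cyl_algebra :: 'a seq set set)) \<nu>" by blast
  let ?\<mu> = "measure_of UNIV cyl_algebra \<nu>"
  have sets: "sets ?\<mu> = sets seq_algebra"
    by (simp add: sets_seq_algebra)
  have em: "emeasure ?\<mu> C = ennreal (m C)" if "C \<in> cyl_algebra" for C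
    using ms \<nu>[OF that] that by (simp add: emeasure_measure_of_conv)
  have "prob_space ?\<mu>"
    using em[OF cyl_algebra_UNIV] by (intro prob_spaceI) (simp add: one)
  moreover have "measure ?\<mu> C = m C" if "C \<in> cyl_algebra" for C
    using em[OF that] nonneg[OF that] by (simp add: measure_def)
  ultimately show ?thesis using sets by blast
qed

locale mean_limit =
  fixes L :: "nat \<Rightarrow> ('a::finite seq \<Rightarrow> real) \<Rightarrow> real" and \<mu> :: "'a seq measure"
  assumes mean: "mean_functional (L k)"
    and prob: "prob_space \<mu>"
    and sets_mu: "sets \<mu> = sets seq_algebra"
    and conv: "C \<in> cyl_algebra \<Longrightarrow> (\<lambda>k. L k (indicator C)) \<longlonglongrightarrow> measure \<mu> C"

text \<open>Diagonal extraction over the countably many words gives one subsequence along which all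
  word indicators converge; the limits are finitely additive on cylinder sets and extend to a
  measure.\<close>

lemma mean_limit_exists:
  fixes L :: "nat \<Rightarrow> ('a::finite seq \<Rightarrow> real) \<Rightarrow> real"
  assumes mean: "\<And>k. mean_functional (L k)"
  shows "\<exists>s \<mu>. strict_mono (s :: nat \<Rightarrow> nat) \<and> mean_limit (\<lambda>k. L (s k)) \<mu>"
proof -
  let ?I = "\<lambda>w :: 'a list. indicator {y. map y [0..<length w] = w} :: 'a seq \<Rightarrow> real"
  have countable: "countable (UNIV :: 'a list set)"
    using countable_lists[of "UNIV :: 'a set"] by simp
  have bound: "norm (L k (?I w)) \<le> 1" for k w
  proof -
    interpret mean_functional "L k" by (rule mean)
    show ?thesis
      using nonneg[of "?I w"] le_const[of "?I w" 1] by (auto simp: indicator_def)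
  qed
  have "\<exists>s :: nat \<Rightarrow> nat. strict_mono s \<and> (\<forall>w. \<exists>l. (\<lambda>k. L (s k) (?I w)) \<longlonglongrightarrow> l)"
    by (rule function_convergent_subsequence[OF countable, where f = "\<lambda>k w. L k (?I w)" and M = 1, OF bound])
       blast
  then obtain s where s: "strict_mono (s :: nat \<Rightarrow> nat)"
    and lim: "\<And>w. \<exists>l. (\<lambda>k. L (s k) (?I w)) \<longlonglongrightarrow> l" by blast
  define l where "l w = lim (\<lambda>k. L (s k) (?I w))" for w
  have l: "(\<lambda>k. L (s k) (?I w)) \<longlonglongrightarrow> l w" for w
    using lim[of w] unfolding l_def by (simp add: convergent_LIMSEQ_iff[symmetric] convergent_def)
  define m where "m C = lim (\<lambda>k. L (s k) (indicator C))" for C :: "'a seq set"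
  have m: "(\<lambda>k. L (s k) (indicator C)) \<longlonglongrightarrow> m C" if C: "C \<in> cyl_algebra" for C
  proof -
    obtain n where n: "depends n (\<lambda>x. x \<in> C)" by (rule cyl_algebraE[OF C])
    then have "depends n (indicator C :: 'a seq \<Rightarrow> real)" by (auto simp: depends_def indicator_def)
    then have "(\<lambda>k. L (s k) (indicator C))
        = (\<lambda>k. \<Sum>w | length w = n. indicator C ((!) w) * L (s k) (?I w))"
      using mean_functional_depends[OF mean] by fastforce
    moreover have "(\<lambda>k. \<Sum>w | length w = n. indicator C ((!) w) * L (s k) (?I w))
        \<longlonglongrightarrow> (\<Sum>w | length w = n. indicator C ((!) w) * l w)"
      by (intro tendsto_sum tendsto_mult_left l)
    ultimately have "convergent (\<lambda>k. L (s k) (indicator C))" by (auto simp: convergent_def)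
    then show ?thesis unfolding m_def by (simp add: convergent_LIMSEQ_iff)
  qed
  have "0 \<le> m C" if "C \<in> cyl_algebra" for C
    using mean_functional.nonneg[OF mean]
    by (intro LIMSEQ_le_const[OF m[OF that]]) auto
  moreover have "m (C \<union> D) = m C + m D"
    if "C \<in> cyl_algebra" "D \<in> cyl_algebra" "C \<inter> D = {}" for C D
  proof -
    have "(indicator (C \<union> D) :: 'a seq \<Rightarrow> real) = (\<lambda>x. indicator C x + indicator D x)"
      using that(3) by (intro ext) (auto simp: indicator_def)
    then have "(\<lambda>k. L (s k) (indicator (C \<union> D))) \<longlonglongrightarrow> m C + m D"
      using tendsto_add[OF m[OF that(1)] m[OF that(2)]] mean_functional.add[OF mean] by simp
    with m[OF cyl_algebra_Un[OF that(1,2)]] show ?thesis by (rule LIMSEQ_unique)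
  qed
  moreover have "m UNIV = 1"
  proof -
    have "(\<lambda>k. L (s k) (indicator UNIV)) = (\<lambda>_. 1)"
      using mean_functional.one[OF mean] by (simp add: indicator_def)
    then show ?thesis
      using m[OF cyl_algebra_UNIV] by (simp add: LIMSEQ_const_iff)
  qed
  ultimately have "\<exists>\<mu>. prob_space \<mu> \<and> sets \<mu> = sets seq_algebra \<and> (\<forall>C\<in>cyl_algebra. measure \<mu> C = m C)"
    by (rule cyl_algebra_measure_exists)
  then obtain \<mu> where \<mu>: "prob_space \<mu>" "sets \<mu> = sets seq_algebra"
    "\<And>C. C \<in> cyl_algebra \<Longrightarrow> measure \<mu> C = m C"
    by blast
  have "mean_limit (\<lambda>k. L (s k)) \<mu>"
  proof (rule mean_limit.intro)
    show "(\<lambda>k. L (s k) (indicator C)) \<longlonglongrightarrow> measure \<mu> C" if "C \<in> cyl_algebra" for C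
      using m[OF that] \<mu>(3)[OF that] by simp
  qed (rule mean \<mu>)+
  with s show ?thesis by blast
qed

section \<open>Convergence of means to integrals\<close>

context mean_limit
begin

sublocale prob_space \<mu> by (rule prob)

lemma space_mu [simp]: "space \<mu> = UNIV"
  using sets_eq_imp_space_eq[OF sets_mu] by simp

lemma measurable_mu [measurable_cong]: "sets \<mu> = sets seq_algebra"
  by (rule sets_mu)

lemma cyl_algebra_sets_mu: "C \<in> cyl_algebra \<Longrightarrow> C \<in> sets \<mu>"
  by (simp add: sets_mu cyl_algebra_sets)

lemma integrable_bounded:
  fixes u :: "'a seq \<Rightarrow> real"
  assumes "u \<in> borel_measurable seq_algebra" "\<And>x. 0 \<le> u x" "\<And>x. u x \<le> 1"
  shows "integrable \<mu> u"
proof -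
  have "u \<in> borel_measurable \<mu>" using assms(1) by measurable
  with assms show ?thesis by (intro integrable_const_bound[of _ 1]) auto
qed

lemma conv_depends:
  assumes h: "depends n h"
  shows "(\<lambda>k. L k h) \<longlonglongrightarrow> integral\<^sup>L \<mu> h"
proof -
  let ?I = "\<lambda>w :: 'a list. {y. map y [0..<n] = w}"
  have I: "?I w \<in> sets \<mu>" for w
    by (intro cyl_algebra_sets_mu word_set_in_cyl_algebra)
  have "integral\<^sup>L \<mu> h = (\<integral>x. (\<Sum>w | length w = n. h ((!) w) * indicator (?I w) x) \<partial>\<mu>)"
    by (intro Bochner_Integration.integral_cong refl depends_eq_sum h)
  also have "\<dots> = (\<Sum>w | length w = n. h ((!) w) * measure \<mu> (?I w))"
    using I by (subst Bochner_Integration.integral_sum) (auto simp: emeasure_eq_measure)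
  finally have "integral\<^sup>L \<mu> h = (\<Sum>w | length w = n. h ((!) w) * measure \<mu> (?I w))" .
  moreover have "(\<lambda>k. \<Sum>w | length w = n. h ((!) w) * L k (indicator (?I w)))
      \<longlonglongrightarrow> (\<Sum>w | length w = n. h ((!) w) * measure \<mu> (?I w))"
    by (intro tendsto_sum tendsto_mult_left conv word_set_in_cyl_algebra)
  ultimately show ?thesis
    using mean_functional_depends[OF mean h] by simp
qed

end

context mean_limit
begin

text \<open>Off a cylinder neighbourhood of \<open>E\<close> the function is uniformly continuous by compactness, so it is
  close to a locally constant function there.\<close>

lemma conv_continuous_off:
  fixes u :: "'a seq \<Rightarrow> real"
  assumes u: "u \<in> borel_measurable seq_algebra" "\<And>x. 0 \<le> u x" "\<And>x. u x \<le> 1"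
    and cont: "\<And>x. x \<notin> E \<Longrightarrow> (u \<longlongrightarrow> u x) (nhdsin seq_topology x)"
    and small: "(\<lambda>n. measure \<mu> (cyls n E)) \<longlonglongrightarrow> 0"
  shows "(\<lambda>k. L k u) \<longlonglongrightarrow> integral\<^sup>L \<mu> u"
proof (rule tendstoI)
  fix e :: real assume "e > 0"
  \<comment> \<open>The final estimate adds errors below \<open>2 * d\<close> (means of
    \<open>u\<close> and \<open>h\<close>), \<open>d\<close> (mean and integral of \<open>h\<close>)
    and \<open>2 * d\<close> (integrals of \<open>h\<close> and \<open>u\<close>).\<close>
  define d where "d = e / 5"
  have d: "d > 0" using \<open>e > 0\<close> by (simp add: d_def)
  have "eventually (\<lambda>n. measure \<mu> (cyls n E) < d) sequentially"
    using small d by (rule order_tendstoD)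
  then obtain n where n: "measure \<mu> (cyls n E) < d" by (auto simp: eventually_sequentially)
  define U where "U = cyls n E"
  have U: "U \<in> cyl_algebra" unfolding U_def by (rule cyls_in_cyl_algebra)
  \<comment> \<open>The points off \<open>U\<close> around which \<open>u\<close> still oscillates
    by \<open>d\<close> on the \<open>m\<close>-cylinder. These are decreasing cylinder sets, and a
    point common to all of them would be a discontinuity outside \<open>E\<close>.\<close>
  define B where "B m = {x. x \<notin> U \<and> (\<exists>z\<in>cyl m x. \<exists>z'\<in>cyl m x. d \<le> \<bar>u z - u z'\<bar>)}" for m
  have "\<exists>m. B m = {}"
  proof (rule ccontr)
    assume ne: "\<not> (\<exists>m. B m = {})"
    have "B m \<in> cyl_algebra" for m
    proof (rule cyl_algebraI)
      have "cyl m y = cyl m x" if "y \<in> cyl (max n m) x" for x y :: "'a seq"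
        using that cyl_antimono[of m "max n m" x] by (auto intro: cyl_trans cyl_sym)
      moreover have "y \<in> U \<longleftrightarrow> x \<in> U" if "y \<in> cyl (max n m) x" for x y
        using dependsD[OF depends_mono[OF depends_cyls, of n "max n m"] that]
        unfolding U_def by simp
      ultimately show "depends (max n m) (\<lambda>x. x \<in> B m)"
        unfolding depends_def B_def by simp
    qed
    moreover have "decseq B"
      unfolding decseq_def B_def using cyl_antimono by blast
    ultimately have "(\<Inter>m. B m) \<noteq> {}" using ne by (intro cyl_algebra_nest) auto
    then obtain x where x: "\<And>m. x \<in> B m" by blast
    then have "x \<notin> E" using subset_cyls[of E n] by (auto simp: B_def U_def)
    from tendstoD[OF cont[OF this], of "d / 2"] d obtain m
      where m: "\<forall>z\<in>cyl m x. dist (u z) (u x) < d / 2"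
      unfolding eventually_nhdsin_seq by auto
    from x[of m] obtain z z' where z: "z \<in> cyl m x" "z' \<in> cyl m x" "d \<le> \<bar>u z - u z'\<bar>"
      unfolding B_def by blast
    have "dist (u z) (u z') < d"
      using dist_triangle_half_l[OF bspec[OF m z(1)] bspec[OF m z(2)]] .
    with z(3) show False by (simp add: dist_real_def)
  qed
  then obtain m where m: "B m = {}" by blast
  \<comment> \<open>The chosen representative shares its last \<open>m\<close> letters with
    \<open>x\<close>, so \<open>h\<close> samples \<open>u\<close> once on each
    \<open>m\<close>-cylinder.\<close>
  define h where "h x = u ((!) (map x [0..<m]))" for x
  have h: "depends m h" unfolding depends_def h_def by (simp add: map_upt_eq_iff[THEN iffD2])
  \<comment> \<open>Off \<open>U\<close> the bound comes from \<open>B m = {}\<close>; on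
    \<open>U\<close> the two values in [0,1] differ by at most 1. The majorant is locally constant,
    so its means converge to its integral.\<close>
  have close: "\<bar>u x - h x\<bar> \<le> d + indicator U x" for x
  proof (cases "x \<in> U")
    case True
    have "\<bar>u x - h x\<bar> \<le> 1"
      using u(2)[of x] u(3)[of x] u(2)[of "(!) (map x [0..<m])"] u(3)[of "(!) (map x [0..<m])"]
      unfolding h_def by linarith
    with True d show ?thesis by simp
  next
    case False
    have "x \<notin> B m" using m by simp
    with False have "\<not> d \<le> \<bar>u x - u ((!) (map x [0..<m]))\<bar>"
      unfolding B_def using nth_map_in_cyl cyl_self by blast
    with False show ?thesis by (simp add: h_def)
  qed
  have dU: "depends n (\<lambda>x. d + indicator U x)"
    using depends_cyls[of n E] unfolding depends_def U_def by (simp add: indicator_def)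
  have int_h: "integrable \<mu> h"
    using depends_measurable[OF h] u by (intro integrable_bounded) (auto simp: h_def)
  have int_u: "integrable \<mu> u" by (intro integrable_bounded u)
  have Us: "U \<in> sets \<mu>" using U by (rule cyl_algebra_sets_mu)
  have int_dU: "integrable \<mu> (\<lambda>x. d + indicator U x)"
    using Us by (intro Bochner_Integration.integrable_add) (auto simp: emeasure_eq_measure)
  have int_dU_eq: "(\<integral>x. d + indicator U x \<partial>\<mu>) = d + measure \<mu> U"
    using Us by (subst Bochner_Integration.integral_add) (auto simp: emeasure_eq_measure prob_space[simplified])
  have "\<bar>integral\<^sup>L \<mu> u - integral\<^sup>L \<mu> h\<bar> = \<bar>\<integral>x. u x - h x \<partial>\<mu>\<bar>"
    using int_u int_h by simp
  also have "\<dots> \<le> (\<integral>x. \<bar>u x - h x\<bar> \<partial>\<mu>)" by (rule integral_abs_bound)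
  also have "\<dots> \<le> (\<integral>x. d + indicator U x \<partial>\<mu>)"
    using int_u int_h int_dU close by (intro integral_mono) auto
  also have "\<dots> < 2 * d" using n by (simp add: int_dU_eq[unfolded U_def] U_def)
  finally have uh: "\<bar>integral\<^sup>L \<mu> u - integral\<^sup>L \<mu> h\<bar> < 2 * d" .
  have "eventually (\<lambda>k. L k (\<lambda>x. d + indicator U x) < 2 * d) sequentially"
    using conv_depends[OF dU] n by (intro order_tendstoD) (simp add: int_dU_eq[unfolded U_def] U_def)+
  moreover have "eventually (\<lambda>k. dist (L k h) (integral\<^sup>L \<mu> h) < d) sequentially"
    using conv_depends[OF h] d by (rule tendstoD)
  ultimately show "eventually (\<lambda>k. dist (L k u) (integral\<^sup>L \<mu> u) < e) sequentially"
  proof eventually_elim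
    case (elim k)
    have "\<bar>L k u - L k h\<bar> \<le> L k (\<lambda>x. d + indicator U x)"
      by (rule mean_functional.abs_diff_le[OF mean close])
    moreover have "dist (L k u) (integral\<^sup>L \<mu> u) \<le> dist (L k u) (L k h)
        + (dist (L k h) (integral\<^sup>L \<mu> h) + dist (integral\<^sup>L \<mu> h) (integral\<^sup>L \<mu> u))"
      using dist_triangle[of "L k u" "integral\<^sup>L \<mu> u" "L k h"]
        dist_triangle[of "L k h" "integral\<^sup>L \<mu> u" "integral\<^sup>L \<mu> h"] by linarith
    ultimately show ?case
      using elim uh unfolding d_def dist_real_def abs_minus_commute[of "integral\<^sup>L \<mu> h"] by linarith
  qed
qed

end

section \<open>The transfer operator of a \<open>g\<close>-function\<close>

definition transfer :: "('a::finite seq \<Rightarrow> real) \<Rightarrow> ('a seq \<Rightarrow> real) \<Rightarrow> 'a seq \<Rightarrow> real" where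
  "transfer g f y = (\<Sum>a\<in>UNIV. g (snoc y a) * f (snoc y a))"

text \<open>Cesaro averages along an arbitrary base point, here \<open>undefined\<close>;
  \<open>Suc k\<close> keeps the divisor positive.\<close>

definition transfer_mean :: "('a::finite seq \<Rightarrow> real) \<Rightarrow> nat \<Rightarrow> ('a seq \<Rightarrow> real) \<Rightarrow> real" where
  "transfer_mean g k f = (\<Sum>j<Suc k. (transfer g ^^ j) f undefined) / real (Suc k)"

context
  fixes g :: "'a::finite seq \<Rightarrow> real"
  assumes g: "g_function g"
begin

lemma g_nonneg: "0 \<le> g x" and g_le_1: "g x \<le> 1"
  using g unfolding g_function_def by (auto simp: image_subset_iff)

lemma g_sum: "(\<Sum>a\<in>UNIV. g (snoc x a)) = 1"
  using g unfolding g_function_def by simp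

lemma g_measurable [measurable]: "g \<in> borel_measurable seq_algebra"
  using g unfolding g_function_def by simp

text \<open>Positivity comes from \<open>g \<ge> 0\<close> and normalisation from the sums over last
  letters being 1. The induction needs the base point to be free.\<close>

lemma mean_functional_transfer: "mean_functional (\<lambda>f. (transfer g ^^ j) f y)"
proof (induction j arbitrary: y)
  case 0
  show ?case by (rule mean_functional.intro) auto
next
  case (Suc j y)
  interpret mean_functional "\<lambda>f. (transfer g ^^ j) f w" for w by (rule Suc)
  show ?case
  proof
    show "(transfer g ^^ Suc j) (\<lambda>x. f x + h x) y
      = (transfer g ^^ Suc j) f y + (transfer g ^^ Suc j) h y" for f h
      by (simp add: transfer_def add sum.distrib distrib_left)
    show "(transfer g ^^ Suc j) (\<lambda>x. c * f x) y = c * (transfer g ^^ Suc j) f y" for c f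
      by (simp add: transfer_def scale sum_distrib_left mult.left_commute)
    show "(transfer g ^^ Suc j) f y \<le> (transfer g ^^ Suc j) h y" if "\<And>x. f x \<le> h x" for f h
      using mono[OF that] by (auto simp: transfer_def intro!: sum_mono mult_left_mono g_nonneg)
    show "(transfer g ^^ Suc j) (\<lambda>_. 1) y = 1"
      by (simp add: transfer_def one g_sum)
  qed
qed

lemma mean_functional_transfer_mean: "mean_functional (transfer_mean g k)"
proof -
  interpret mean_functional "\<lambda>f. (transfer g ^^ j) f w" for j w by (rule mean_functional_transfer)
  show ?thesis
  proof
    show "transfer_mean g k (\<lambda>x. f x + h x) = transfer_mean g k f + transfer_mean g k h" for f h
      unfolding transfer_mean_def by (simp only: add sum.distrib add_divide_distrib)
    show "transfer_mean g k (\<lambda>x. c * f x) = c * transfer_mean g k f" for c f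
      unfolding transfer_mean_def by (simp only: scale sum_distrib_left[symmetric] times_divide_eq_right)
    show "transfer_mean g k f \<le> transfer_mean g k h" if "\<And>x. f x \<le> h x" for f h
      unfolding transfer_mean_def by (intro divide_right_mono sum_mono mono that) simp
    show "transfer_mean g k (\<lambda>_. 1) = 1"
      unfolding transfer_mean_def by (simp only: one) simp
  qed
qed

text \<open>The sum telescopes, leaving two end terms in [0,1]; thus the averages become invariant
  under the transfer operator in the limit.\<close>

lemma transfer_mean_diff:
  assumes "\<And>x. 0 \<le> f x" "\<And>x. f x \<le> 1"
  shows "\<bar>transfer_mean g k (transfer g f) - transfer_mean g k f\<bar> \<le> inverse (real (Suc k))"
proof -
  interpret mean_functional "\<lambda>f. (transfer g ^^ j) f w" for j w by (rule mean_functional_transfer)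
  let ?a = "\<lambda>j. (transfer g ^^ j) f undefined"
  have "(transfer g ^^ j) (transfer g f) = (transfer g ^^ Suc j) f" for j
    by (simp add: funpow_swap1)
  then have "transfer_mean g k (transfer g f) - transfer_mean g k f
      = (\<Sum>j<Suc k. ?a (Suc j) - ?a j) / real (Suc k)"
    by (simp only: transfer_mean_def sum_subtractf diff_divide_distrib)
  also have "\<dots> = (?a (Suc k) - ?a 0) / real (Suc k)"
    by (rule arg_cong[OF sum_lessThan_telescope])
  finally have eq: "transfer_mean g k (transfer g f) - transfer_mean g k f
      = (?a (Suc k) - ?a 0) / real (Suc k)" .
  have "0 \<le> ?a j" "?a j \<le> 1" for j using assms by (auto intro: nonneg le_const)
  then have "\<bar>?a (Suc k) - ?a 0\<bar> \<le> 1" by (smt (verit))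
  from divide_right_mono[OF this, of "real (Suc k)"] show ?thesis
    by (simp only: eq abs_divide abs_of_nat inverse_eq_divide of_nat_0_le_iff simp_thms)
qed

text \<open>Each application removes the last letter of the word and yields a factor of
  \<open>g\<close>, at most \<open>r\<close> as long as \<open>N\<close> earlier letters are still
  prescribed. The remaining steps contribute at most 1, whence the truncated exponent
  \<open>n - N\<close>.\<close>

lemma transfer_cyl_le:
  assumes r: "0 \<le> r"
    and le: "\<And>i z. (\<And>j. j < N \<Longrightarrow> z (Suc j) = x (i + Suc j)) \<Longrightarrow> g z \<le> r"
  shows "(transfer g ^^ n) (indicator (cyl n x)) y \<le> r ^ (n - N)"
  using le
proof (induction n arbitrary: x)
  case 0
  then show ?case by (simp add: indicator_def)
next
  case (Suc n x)
  interpret mean_functional "\<lambda>f. (transfer g ^^ j) f w" for j w by (rule mean_functional_transfer)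
  show ?case
  proof (cases "n < N")
    case True
    have "(transfer g ^^ Suc n) (indicator (cyl (Suc n) x)) y \<le> 1"
      by (rule le_const) (simp add: indicator_def)
    with True show ?thesis by simp
  next
    case False
    have "transfer g (indicator (cyl (Suc n) x)) z \<le> r * indicator (cyl n (seq_shift x)) z" for z
    proof -
      have "transfer g (indicator (cyl (Suc n) x)) z
          = (\<Sum>a\<in>{x 0}. g (snoc z a) * indicator (cyl (Suc n) x) (snoc z a))"
        \<comment> \<open>Only the letter \<open>x 0\<close> keeps \<open>snoc z a\<close> in the
          cylinder.\<close>
        unfolding transfer_def
        by (rule sum.mono_neutral_right) (auto simp: snoc_in_cyl_Suc indicator_def)
      also have "\<dots> = g (snoc z (x 0)) * indicator (cyl n (seq_shift x)) z"
        by (simp add: snoc_in_cyl_Suc indicator_def)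
      also have "\<dots> \<le> r * indicator (cyl n (seq_shift x)) z"
      proof (cases "z \<in> cyl n (seq_shift x)")
        case True
        then have "g (snoc z (x 0)) \<le> r"
          \<comment> \<open>As \<open>n \<ge> N\<close>, the sequence \<open>snoc z (x 0)\<close>
            agrees with \<open>x\<close> in the \<open>N\<close> letters before the last; this is
            the case \<open>i = 0\<close>.\<close>
          using False by (intro Suc.prems[of _ 0]) (simp add: cyl_def seq_shift_def)
        with True show ?thesis by simp
      qed simp
      finally show ?thesis .
    qed
    then have "(transfer g ^^ n) (transfer g (indicator (cyl (Suc n) x))) y
        \<le> (transfer g ^^ n) (\<lambda>z. r * indicator (cyl n (seq_shift x)) z) y"
      by (rule mono)
    also have "\<dots> = r * (transfer g ^^ n) (indicator (cyl n (seq_shift x))) y"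
      by (rule scale)
    also have "\<dots> \<le> r * r ^ (n - N)"
    proof (intro mult_left_mono r Suc.IH)
      fix i z assume "\<And>j. j < N \<Longrightarrow> z (Suc j) = seq_shift x (i + Suc j)"
      then show "g z \<le> r" by (intro Suc.prems[of z "Suc i"]) (simp add: seq_shift_def)
    qed
    finally show ?thesis using False by (simp add: funpow_swap1 Suc_diff_le)
  qed
qed

end

text \<open>Hypothesis (1) gives this with \<open>N = 0\<close>; hypothesis (2) gives it because every tail of a
  discontinuity point is then a discontinuity point.\<close>

definition orbit_bound :: "('a seq \<Rightarrow> real) \<Rightarrow> nat \<Rightarrow> real \<Rightarrow> 'a seq \<Rightarrow> bool" where
  "orbit_bound g N r x \<longleftrightarrow> (\<forall>i z. (\<forall>j<N. z (Suc j) = x (i + Suc j)) \<longrightarrow> g z \<le> r)"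

lemma orbit_bound_shift: "orbit_bound g N r x \<Longrightarrow> orbit_bound g N r (seq_shift x)"
  unfolding orbit_bound_def seq_shift_def by (metis add_Suc)

section \<open>Word counts against geometric decay\<close>

lemma words_seq_shift: "words (seq_shift ` D) n = butlast ` words D (Suc n)"
proof -
  \<comment> \<open>Words end with \<open>x 0\<close>, the letter that the shift deletes; so words
    of the shifted set are obtained by \<open>butlast\<close> from words one letter longer.\<close>
  have "rev (map (seq_shift x) [0..<n]) = butlast (rev (map x [0..<Suc n]))" for x :: "'a seq"
    unfolding upt_conv_Cons[OF zero_less_Suc]
    by (simp add: map_Suc_upt[symmetric] seq_shift_def comp_def del: upt_Suc)
  then show ?thesis unfolding words_def image_image by simp
qed

lemma words_Suc: "words D n = tl ` words D (Suc n)"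
  unfolding words_def image_image by simp

lemma finite_words: "finite (words (D :: 'a::finite seq set) n)"
  by (rule finite_subset[OF _ finite_words_length[of n]]) (auto simp: words_def)

text \<open>With \<open>q\<close> strictly between the growth rate and \<open>1 / r\<close>, the
  word count is eventually at most \<open>q ^ Suc n\<close>, so the product is dominated by a
  multiple of \<open>(q * r) ^ n\<close> with \<open>q * r < 1\<close>. The length
  \<open>Suc n\<close> accommodates the words of the shifted set.\<close>

lemma growth_times_power_tendsto_0:
  fixes D :: "'a::finite seq set"
  assumes r: "0 < r" and growth: "upper_growth_rate D < ereal (inverse r)"
  shows "(\<lambda>n. real (card (words D (Suc n))) * r ^ (n - N)) \<longlonglongrightarrow> 0"
proof -
  obtain q where q: "upper_growth_rate D < ereal q" "ereal q < ereal (inverse r)"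
    using ereal_dense2[OF growth] by blast
  have "eventually (\<lambda>n. ereal (root n (real (card (words D n)))) < ereal q) sequentially"
    using q(1) unfolding upper_growth_rate_def by (rule Limsup_lessD)
  then have "eventually (\<lambda>n. ereal (root (Suc n) (real (card (words D (Suc n))))) < ereal q) sequentially"
    by (subst eventually_sequentially_Suc)
  then have ev: "eventually (\<lambda>n. 0 \<le> real (card (words D (Suc n))) * r ^ (n - N)
      \<and> real (card (words D (Suc n))) * r ^ (n - N) \<le> q / r ^ N * (q * r) ^ n) sequentially"
    using eventually_ge_at_top[of N]
  proof eventually_elim
    case (elim n)
    let ?c = "real (card (words D (Suc n)))"
    have root: "0 \<le> root (Suc n) ?c" "root (Suc n) ?c \<le> q"
      using elim(1) by (simp_all add: real_root_ge_zero)
    have "?c = root (Suc n) ?c ^ Suc n" by (rule real_root_pow_pos2[symmetric]) auto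
    also have "\<dots> \<le> q ^ Suc n" using root by (intro power_mono) auto
    finally have "?c * r ^ (n - N) \<le> q ^ Suc n * r ^ (n - N)"
      using r by (intro mult_right_mono) auto
    \<comment> \<open>Here \<open>n \<ge> N\<close> makes the subtraction in the exponent
      exact.\<close>
    also have "\<dots> = q / r ^ N * (q * r) ^ n"
      using r elim(2) by (simp add: power_diff power_mult_distrib)
    finally show ?case using r by simp
  qed
  have "0 \<le> q"
  proof -
    obtain n where "ereal (root n (real (card (words D n)))) < ereal q"
      using Limsup_lessD[OF q(1)[unfolded upper_growth_rate_def]]
      unfolding eventually_sequentially by blast
    then show ?thesis using real_root_ge_zero[of "real (card (words D n))" n] by simp
  qed
  then have "norm (q * r) < 1" using q(2) r by (simp add: field_simps)
  then have "(\<lambda>n. q / r ^ N * (q * r) ^ n) \<longlonglongrightarrow> q / r ^ N * 0"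
    by (intro tendsto_mult_left LIMSEQ_power_zero)
  then have "(\<lambda>n. q / r ^ N * (q * r) ^ n) \<longlonglongrightarrow> 0" by simp
  from tendsto_sandwich[OF _ _ tendsto_const this] ev show ?thesis
    by (simp add: eventually_conj_iff)
qed

section \<open>Invariance and decay of cylinder measures for the limit\<close>

locale transfer_limit =
  mean_limit "\<lambda>k. transfer_mean g (s k)" \<mu> for g :: "'a::finite seq \<Rightarrow> real" and s \<mu> +
  assumes g: "g_function g" and s: "strict_mono s"
begin

lemma transfer_bounds:
  assumes "\<And>x. 0 \<le> f x" "\<And>x. f x \<le> 1"
  shows "0 \<le> (transfer g ^^ n) f x" "(transfer g ^^ n) f x \<le> 1"
proof -
  interpret mean_functional "\<lambda>f. (transfer g ^^ n) f x" by (rule mean_functional_transfer[OF g])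
  show "0 \<le> (transfer g ^^ n) f x" "(transfer g ^^ n) f x \<le> 1"
    using assms by (auto intro: nonneg le_const)
qed

text \<open>One application of the transfer operator changes the averages by at most
  \<open>1 / Suc (s k)\<close>, which tends to 0 because \<open>s\<close> is strictly
  increasing.\<close>

lemma conv_transfer:
  assumes f: "\<And>x. 0 \<le> f x" "\<And>x. f x \<le> 1" and lim: "(\<lambda>k. transfer_mean g (s k) f) \<longlonglongrightarrow> l"
  shows "(\<lambda>k. transfer_mean g (s k) (transfer g f)) \<longlonglongrightarrow> l"
proof -
  have "(\<lambda>k. inverse (real (Suc (s k)))) \<longlonglongrightarrow> 0"
    using LIMSEQ_subseq_LIMSEQ[OF LIMSEQ_inverse_real_of_nat s] by (simp add: comp_def)
  then have "(\<lambda>k. transfer_mean g (s k) (transfer g f) - transfer_mean g (s k) f) \<longlonglongrightarrow> 0"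
    by (rule Lim_null_comparison[rotated]) (simp add: transfer_mean_diff[OF g f] del: of_nat_Suc)
  from tendsto_add[OF this lim] show ?thesis by simp
qed

lemma conv_funpow_transfer:
  assumes f: "\<And>x. 0 \<le> f x" "\<And>x. f x \<le> 1" and lim: "(\<lambda>k. transfer_mean g (s k) f) \<longlonglongrightarrow> l"
  shows "(\<lambda>k. transfer_mean g (s k) ((transfer g ^^ n) f)) \<longlonglongrightarrow> l"
proof (induction n)
  case 0
  show ?case using lim by simp
next
  case (Suc n)
  show ?case unfolding funpow.simps comp_def
    by (intro conv_transfer transfer_bounds f Suc)
qed

text \<open>Applying the operator \<open>n\<close> times to the indicator does not change the limit
  of the averages, while it makes the function at most \<open>r ^ (n - N)\<close>
  everywhere.\<close>

lemma measure_cyl_le: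
  assumes "0 \<le> r" "orbit_bound g N r x"
  shows "measure \<mu> (cyl n x) \<le> r ^ (n - N)"
proof (rule LIMSEQ_le_const2)
  show "(\<lambda>k. transfer_mean g (s k) ((transfer g ^^ n) (indicator (cyl n x)))) \<longlonglongrightarrow> measure \<mu> (cyl n x)"
    by (intro conv_funpow_transfer conv cyl_in_cyl_algebra) (auto simp: indicator_def)
  have "(transfer g ^^ n) (indicator (cyl n x)) y \<le> r ^ (n - N)" for y
    using assms(2) by (intro transfer_cyl_le[OF g assms(1)]) (auto simp: orbit_bound_def)
  then show "\<exists>m. \<forall>k\<ge>m. transfer_mean g (s k) ((transfer g ^^ n) (indicator (cyl n x))) \<le> r ^ (n - N)"
    using mean_functional.le_const[OF mean] by blast
qed

lemma measure_cyls_le: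
  assumes "0 \<le> r" "\<And>x. x \<in> E \<Longrightarrow> orbit_bound g N r x"
  shows "measure \<mu> (cyls n E) \<le> real (card (words E n)) * r ^ (n - N)"
proof -
  let ?C = "\<lambda>w. {y. rev (map y [0..<n]) = w}"
  have C: "?C (rev (map x [0..<n])) = cyl n x" for x :: "'a seq"
    by (simp only: rev_is_rev_conv map_upt_eq_iff Collect_mem_eq)
  have "cyls n E = (\<Union>w\<in>words E n. ?C w)"
    unfolding words_def image_image cyls_def by (simp only: UN_simps C)
  also have "measure \<mu> \<dots> \<le> (\<Sum>w\<in>words E n. measure \<mu> (?C w))"
  proof (rule measure_UNION_le[OF finite_words])
    fix w assume "w \<in> words E n"
    then obtain x where w: "w = rev (map x [0..<n])" by (auto simp: words_def)
    show "?C w \<in> sets \<mu>" unfolding w C by (intro cyl_algebra_sets_mu cyl_in_cyl_algebra)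
  qed
  also have "\<dots> \<le> of_nat (card (words E n)) * r ^ (n - N)"
  proof (rule sum_bounded_above)
    fix w assume "w \<in> words E n"
    then obtain x where w: "w = rev (map x [0..<n])" "x \<in> E" by (auto simp: words_def)
    show "measure \<mu> (?C w) \<le> r ^ (n - N)"
      unfolding w(1) C by (rule measure_cyl_le[OF assms(1) assms(2)[OF w(2)]])
  qed
  finally show ?thesis by simp
qed

lemma measure_cyls_tendsto_0:
  assumes "0 < r" "upper_growth_rate D < ereal (inverse r)"
    and "\<And>x. x \<in> E \<Longrightarrow> orbit_bound g N r x"
    and card: "\<And>n. card (words E n) \<le> card (words D (Suc n))"
  shows "(\<lambda>n. measure \<mu> (cyls n E)) \<longlonglongrightarrow> 0"
proof (rule tendsto_sandwich[OF _ _ tendsto_const growth_times_power_tendsto_0[OF assms(1,2), of N]])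
  have "measure \<mu> (cyls n E) \<le> real (card (words D (Suc n))) * r ^ (n - N)" for n
    using assms(1) card[of n]
    by (intro order_trans[OF measure_cyls_le[of r E N n]] mult_right_mono assms(3)) auto
  then show "eventually (\<lambda>n. measure \<mu> (cyls n E) \<le> real (card (words D (Suc n))) * r ^ (n - N)) sequentially"
    by simp
qed simp

text \<open>The transfer operator sends \<open>f \<circ> seq_shift\<close> to \<open>f\<close>,
  since the weights sum to 1; the same averages then have both measures as limits.\<close>

lemma measure_shift_vimage:
  assumes C: "C \<in> cyl_algebra"
  shows "measure \<mu> (seq_shift -` C) = measure \<mu> C"
proof (rule LIMSEQ_unique)
  have "transfer g (indicator (seq_shift -` C)) = indicator C"
    using g_sum[OF g] by (intro ext) (simp add: transfer_def indicator_def of_bool_def)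
  then show "(\<lambda>k. transfer_mean g (s k) (indicator C)) \<longlonglongrightarrow> measure \<mu> (seq_shift -` C)"
    using conv_transfer[OF _ _ conv[OF shift_vimage_in_cyl_algebra[OF C]]] by (simp add: indicator_def)
qed (rule conv[OF C])

lemma distr_seq_shift: "distr \<mu> seq_algebra seq_shift = \<mu>"
proof (rule sym, rule seq_measure_eqI)
  fix C :: "'a seq set" assume C: "C \<in> cyl_algebra"
  have "seq_shift \<in> measurable \<mu> seq_algebra" by measurable
  then have "emeasure (distr \<mu> seq_algebra seq_shift) C = emeasure \<mu> (seq_shift -` C)"
    using C by (simp add: emeasure_distr cyl_algebra_sets)
  then show "emeasure \<mu> C = emeasure (distr \<mu> seq_algebra seq_shift) C"
    using measure_shift_vimage[OF C] by (simp add: emeasure_eq_measure)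
qed (auto simp: sets_mu intro: finite_measure_axioms)

section \<open>Conditional probabilities under the limit measure\<close>

context
  assumes small: "(\<lambda>n. measure \<mu> (cyls n (seq_shift ` disc_set g))) \<longlonglongrightarrow> 0"
begin

text \<open>The transfer operator turns the indicator on the left into the integrand on the right.
  That integrand can be discontinuous only on the shifted discontinuity set, whose neighbourhoods
  are small, so its averages converge to its integral.\<close>

lemma measure_shift_vimage_letter:
  assumes C: "C \<in> cyl_algebra"
  shows "measure \<mu> (seq_shift -` C \<inter> {y. y 0 = a}) = (\<integral>x. indicator C x * g (snoc x a) \<partial>\<mu>)"
proof (rule LIMSEQ_unique)
  let ?S = "seq_shift -` C \<inter> {y. y 0 = a}" and ?u = "\<lambda>x. indicator C x * g (snoc x a)"
  have "transfer g (indicator ?S) x = ?u x" for x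
  proof -
    have "transfer g (indicator ?S) x = (\<Sum>b\<in>{a}. g (snoc x b) * indicator ?S (snoc x b))"
      unfolding transfer_def by (rule sum.mono_neutral_right) auto
    then show ?thesis by (simp add: indicator_def)
  qed
  then have eq: "transfer g (indicator ?S) = ?u" by blast
  have "?S \<in> cyl_algebra"
    by (intro cyl_algebra_Int shift_vimage_in_cyl_algebra first_letter_in_cyl_algebra C)
  from conv_transfer[OF _ _ conv[OF this]]
  show "(\<lambda>k. transfer_mean g (s k) ?u) \<longlonglongrightarrow> measure \<mu> ?S"
    unfolding eq by (simp add: indicator_def)
  show "(\<lambda>k. transfer_mean g (s k) ?u) \<longlonglongrightarrow> integral\<^sup>L \<mu> ?u"
  proof (rule conv_continuous_off[OF _ _ _ _ small])
    note g_measurable[OF g, measurable] cyl_algebra_sets[OF C, measurable]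
    show "?u \<in> borel_measurable seq_algebra" by measurable
    show "0 \<le> ?u x" "?u x \<le> 1" for x
      using g_nonneg[OF g] g_le_1[OF g] by (auto simp: indicator_def)
    fix x assume "x \<notin> seq_shift ` disc_set g"
    then have "snoc x a \<notin> disc_set g" by (metis image_eqI seq_shift_snoc)
    then have "(g \<longlongrightarrow> g (snoc x a)) (nhdsin seq_topology (snoc x a))" by (simp add: disc_set_iff)
    then have "((\<lambda>z. g (snoc z a)) \<longlongrightarrow> g (snoc x a)) (nhdsin seq_topology x)"
      using filterlim_snoc by (rule filterlim_compose)
    moreover obtain n where "depends n (\<lambda>x. x \<in> C)" by (rule cyl_algebraE[OF C])
    then have "depends n (indicator C :: 'a seq \<Rightarrow> real)" by (auto simp: depends_def indicator_def)
    then have "((indicator C :: 'a seq \<Rightarrow> real) \<longlongrightarrow> indicator C x) (nhdsin seq_topology x)"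
      by (rule tendsto_depends)
    ultimately show "(?u \<longlongrightarrow> ?u x) (nhdsin seq_topology x)" by (intro tendsto_mult)
  qed
qed

text \<open>Both sides are finite measures in \<open>B\<close>, namely \<open>?\<nu>\<close> and
  \<open>?\<rho>\<close>, and they agree on the cylinder algebra.\<close>

lemma measure_shift_vimage_letter_sets:
  assumes B: "B \<in> sets seq_algebra"
  shows "measure \<mu> (seq_shift -` B \<inter> {y. y 0 = a}) = (\<integral>x. indicator B x * g (snoc x a) \<partial>\<mu>)"
proof -
  let ?A = "{y :: 'a seq. y 0 = a}"
  let ?\<nu> = "distr (density \<mu> (indicator ?A)) seq_algebra seq_shift"
  let ?\<rho> = "density \<mu> (\<lambda>x. ennreal (g (snoc x a)))"
  note g_measurable[OF g, measurable]
  have A: "?A \<in> sets \<mu>" by (intro cyl_algebra_sets_mu first_letter_in_cyl_algebra)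
  have T: "seq_shift \<in> measurable \<mu> seq_algebra" by measurable
  then have T': "seq_shift \<in> measurable (density \<mu> (indicator ?A)) seq_algebra" by simp
  have \<nu>: "emeasure ?\<nu> B = ennreal (measure \<mu> (seq_shift -` B \<inter> ?A))" if B: "B \<in> sets seq_algebra" for B
  proof -
    have "seq_shift -` B \<in> sets \<mu>" using measurable_sets[OF T B] by simp
    then have "emeasure (density \<mu> (indicator ?A)) (seq_shift -` B) = emeasure \<mu> (?A \<inter> seq_shift -` B)"
      using A by (intro emeasure_restricted)
    then show ?thesis
      by (subst emeasure_distr[OF T' B]) (simp add: Int_commute emeasure_eq_measure)
  qed
  have \<rho>: "emeasure ?\<rho> B = ennreal (\<integral>x. indicator B x * g (snoc x a) \<partial>\<mu>)" if B: "B \<in> sets seq_algebra" for B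
  proof -
    note B[measurable]
    have "emeasure ?\<rho> B = (\<integral>\<^sup>+x. ennreal (g (snoc x a)) * indicator B x \<partial>\<mu>)"
      using B by (intro emeasure_density) (auto simp: sets_mu)
    also have "\<dots> = (\<integral>\<^sup>+x. ennreal (indicator B x * g (snoc x a)) \<partial>\<mu>)"
      by (intro nn_integral_cong) (auto simp: indicator_def)
    also have "\<dots> = ennreal (\<integral>x. indicator B x * g (snoc x a) \<partial>\<mu>)"
      using g_nonneg[OF g] g_le_1[OF g]
      by (intro nn_integral_eq_integral integrable_bounded) (auto simp: indicator_def)
    finally show ?thesis .
  qed
  have "?\<nu> = ?\<rho>"
  proof (rule seq_measure_eqI)
    show "finite_measure ?\<nu>"
      using \<nu>[of UNIV] sets.top[of "seq_algebra :: 'a seq measure"] by (intro finite_measureI) simp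
  qed (auto simp: sets_mu \<nu> \<rho> cyl_algebra_sets measure_shift_vimage_letter)
  then have "ennreal (measure \<mu> (seq_shift -` B \<inter> ?A)) = ennreal (\<integral>x. indicator B x * g (snoc x a) \<partial>\<mu>)"
    using \<nu>[OF B] \<rho>[OF B] by simp
  then show ?thesis
    using g_nonneg[OF g] by (subst (asm) ennreal_inj) (auto intro!: integral_nonneg_AE)
qed

lemma g_measure_limit: "g_measure g \<mu>"
proof -
  let ?F = "vimage_algebra UNIV seq_shift (seq_algebra :: 'a seq measure)"
  note g_measurable[OF g, measurable]
  have T: "seq_shift \<in> measurable \<mu> seq_algebra" by measurable
  have F: "sets ?F = {seq_shift -` B | B. B \<in> sets seq_algebra}"
    by (simp add: sets_vimage_algebra2)
  have "finite_measure_subalgebra \<mu> ?F"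
  proof unfold_locales
    show "subalgebra \<mu> ?F"
      unfolding subalgebra_def F using measurable_sets[OF T] by auto
  qed
  then interpret F: finite_measure_subalgebra \<mu> ?F .
  have "AE x in \<mu>. real_cond_exp \<mu> ?F (indicator {y. y 0 = a}) x = g (snoc (seq_shift x) a)" for a
  proof (rule F.real_cond_exp_charact)
    have A: "{y :: 'a seq. y 0 = a} \<in> sets \<mu>"
      by (intro cyl_algebra_sets_mu first_letter_in_cyl_algebra)
    then show "integrable \<mu> (indicator {y. y 0 = a} :: 'a seq \<Rightarrow> real)"
      by (simp add: emeasure_eq_measure)
    show "integrable \<mu> (\<lambda>x. g (snoc (seq_shift x) a))"
      using g_nonneg[OF g] g_le_1[OF g] by (intro integrable_bounded) auto
    have "seq_shift \<in> measurable ?F seq_algebra" by (intro measurable_vimage_algebra1) auto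
    then show "(\<lambda>x. g (snoc (seq_shift x) a)) \<in> borel_measurable ?F"
      by (rule measurable_compose) measurable
    fix S assume "S \<in> sets ?F"
    then obtain B where B: "B \<in> sets seq_algebra" and S: "S = seq_shift -` B" unfolding F by blast
    note B[measurable]
    have Ss: "S \<in> sets \<mu>" using measurable_sets[OF T B] by (simp add: S)
    have "(\<integral>x\<in>S. indicator {y. y 0 = a} x \<partial>\<mu>) = (\<integral>x. indicator (S \<inter> {y. y 0 = a}) x \<partial>\<mu>)"
      unfolding set_lebesgue_integral_def
      by (intro Bochner_Integration.integral_cong) (auto simp: indicator_def)
    also have "\<dots> = measure \<mu> (S \<inter> {y. y 0 = a})"
      using Ss A by simp
    also have "\<dots> = (\<integral>x. indicator B x * g (snoc x a) \<partial>\<mu>)"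
      unfolding S by (rule measure_shift_vimage_letter_sets[OF B])
    \<comment> \<open>Invariance of \<open>\<mu>\<close> brings the shift back into the integrand,
      turning \<open>B\<close> into \<open>S\<close>.\<close>
    also have "\<dots> = (\<integral>x. indicator B x * g (snoc x a) \<partial>(distr \<mu> seq_algebra seq_shift))"
      by (simp only: distr_seq_shift)
    also have "\<dots> = (\<integral>x. indicator B (seq_shift x) * g (snoc (seq_shift x) a) \<partial>\<mu>)"
      by (rule integral_distr[OF T]) measurable
    also have "\<dots> = (\<integral>x\<in>S. g (snoc (seq_shift x) a) \<partial>\<mu>)"
      unfolding set_lebesgue_integral_def S
      by (intro Bochner_Integration.integral_cong) (auto simp: indicator_def)
    finally show "(\<integral>x\<in>S. indicator {y. y 0 = a} x \<partial>\<mu>) = (\<integral>x\<in>S. g (snoc (seq_shift x) a) \<partial>\<mu>)" .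
  qed
  then have "AE x in \<mu>. \<forall>a\<in>UNIV. real_cond_exp \<mu> ?F (indicator {y. y 0 = a}) x = g (snoc (seq_shift x) a)"
    by (subst AE_finite_all) auto
  then show ?thesis
    unfolding g_measure_def using prob sets_mu distr_seq_shift by simp
qed

end

lemma disc_set_null:
  assumes "(\<lambda>n. measure \<mu> (cyls n (disc_set g))) \<longlonglongrightarrow> 0"
  shows "disc_set g \<in> null_sets \<mu>"
proof (rule null_setsI)
  show D: "disc_set g \<in> sets \<mu>" by (simp add: sets_mu disc_set_measurable)
  \<comment> \<open>The discontinuity set lies in each of its cylinder neighbourhoods.\<close>
  have "measure \<mu> (disc_set g) \<le> measure \<mu> (cyls n (disc_set g))" for n
    by (intro finite_measure_mono subset_cyls cyl_algebra_sets_mu cyls_in_cyl_algebra)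
  then have "measure \<mu> (disc_set g) \<le> 0" by (intro LIMSEQ_le_const[OF assms]) blast
  then show "emeasure \<mu> (disc_set g) = 0" by (simp add: emeasure_eq_measure measure_le_0_iff)
qed

end

section \<open>From the two sets of hypotheses to the conclusion\<close>

lemma g_le_of_siblings:
  fixes g :: "'a::finite seq \<Rightarrow> real"
  assumes g: "g_function g" and ge: "\<And>a. \<epsilon> \<le> g (snoc (seq_shift z) a)"
  shows "g z \<le> 1 - (real CARD('a) - 1) * \<epsilon>"
proof -
  \<comment> \<open>The sequences sharing the past of \<open>z\<close> have total weight 1, and the
    \<open>CARD('a) - 1\<close> of them other than \<open>z\<close> weigh at least \<epsilon>
    each.\<close>
  have "1 = (\<Sum>a\<in>UNIV. g (snoc (seq_shift z) a))" using g_sum[OF g] by simp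
  also have "\<dots> = g z + (\<Sum>a\<in>UNIV - {z 0}. g (snoc (seq_shift z) a))"
    by (subst sum.remove[of _ "z 0"]) auto
  also have "\<dots> \<ge> g z + (\<Sum>a\<in>UNIV - {z 0}. \<epsilon>)"
    by (intro add_left_mono sum_mono ge)
  finally show ?thesis by (simp add: card_Diff_singleton of_nat_diff Suc_leI)
qed

text \<open>The common core of both cases, with \<open>r\<close> standing for 1 - (|A| - 1)
  \<epsilon>. Smallness near the shifted discontinuity set yields the \<open>g\<close>-measure;
  smallness near the set itself yields that it is null.\<close>

lemma g_measure_exists:
  fixes g :: "'a::finite seq \<Rightarrow> real"
  assumes g: "g_function g" and r: "0 < r"
    and growth: "upper_growth_rate (disc_set g) < ereal (inverse r)"
    and bound: "\<And>x. x \<in> disc_set g \<Longrightarrow> orbit_bound g N r x"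
  shows "\<exists>\<mu>. g_measure g \<mu> \<and> disc_set g \<in> null_sets \<mu>"
proof -
  let ?D = "disc_set g"
  obtain s \<mu> where s: "strict_mono (s :: nat \<Rightarrow> nat)" and lim: "mean_limit (\<lambda>k. transfer_mean g (s k)) \<mu>"
    using mean_limit_exists[of "transfer_mean g", OF mean_functional_transfer_mean[OF g]] by blast
  from lim s interpret transfer_limit g s \<mu>
    by (intro transfer_limit.intro transfer_limit_axioms.intro g)
  have "card (words (seq_shift ` ?D) n) \<le> card (words ?D (Suc n))" for n
    unfolding words_seq_shift by (rule card_image_le[OF finite_words])
  then have "(\<lambda>n. measure \<mu> (cyls n (seq_shift ` ?D))) \<longlonglongrightarrow> 0"
    using bound by (intro measure_cyls_tendsto_0[OF r growth]) (auto intro: orbit_bound_shift)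
  moreover have "card (words ?D n) \<le> card (words ?D (Suc n))" for n
    unfolding words_Suc[of ?D n] by (rule card_image_le[OF finite_words])
  then have "(\<lambda>n. measure \<mu> (cyls n ?D)) \<longlonglongrightarrow> 0"
    using bound by (intro measure_cyls_tendsto_0[OF r growth])
  ultimately show ?thesis using g_measure_limit disc_set_null by blast
qed

theorem corollary1:
  fixes g :: "'a::finite seq \<Rightarrow> real"
  assumes "g_function g"
    and "(\<exists>\<epsilon>::real. \<epsilon> > 0 \<and>
            (INF x. ereal (g x)) = ereal \<epsilon> \<and>
            upper_growth_rate (disc_set g) < ereal (inverse (1 - (real CARD('a) - 1) * \<epsilon>)))
       \<or> (\<exists>(N::nat) (\<epsilon>::real). \<epsilon> > 0 \<and>
            (INF x\<in>ext_set (disc_set g) N. ereal (g x)) = ereal \<epsilon> \<and>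
            upper_growth_rate (disc_set g) < ereal (inverse (1 - (real CARD('a) - 1) * \<epsilon>)) \<and>
            seq_shift ` disc_set g \<subseteq> disc_set g)"
  shows "\<exists>\<mu>. g_measure g \<mu> \<and> disc_set g \<in> null_sets \<mu>"
  using assms(2)
proof (elim disjE exE conjE)
  fix \<epsilon> :: real
  assume \<epsilon>: "\<epsilon> > 0" and inf: "(INF x. ereal (g x)) = ereal \<epsilon>"
    and growth: "upper_growth_rate (disc_set g) < ereal (inverse (1 - (real CARD('a) - 1) * \<epsilon>))"
  have ge: "\<epsilon> \<le> g x" for x
    using INF_lower[of x UNIV "\<lambda>x. ereal (g x)"] inf by simp
  then have le: "g z \<le> 1 - (real CARD('a) - 1) * \<epsilon>" for z
    by (intro g_le_of_siblings assms(1))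
  \<comment> \<open>Any value of \<open>g\<close> lies between \<epsilon> and this number.\<close>
  then have "0 < 1 - (real CARD('a) - 1) * \<epsilon>"
    using \<epsilon> ge[of undefined] le[of undefined] by linarith
  then show ?thesis
    using growth le by (intro g_measure_exists[OF assms(1), where N = 0]) (auto simp: orbit_bound_def)
next
  fix N :: nat and \<epsilon> :: real
  let ?D = "disc_set g" and ?r = "1 - (real CARD('a) - 1) * \<epsilon>"
  assume \<epsilon>: "\<epsilon> > 0" and inf: "(INF x\<in>ext_set ?D N. ereal (g x)) = ereal \<epsilon>"
    and growth: "upper_growth_rate ?D < ereal (inverse ?r)"
    and inv: "seq_shift ` ?D \<subseteq> ?D"
  have ge: "\<epsilon> \<le> g z" if "z \<in> ext_set ?D N" for z
    using INF_lower[OF that, of "\<lambda>x. ereal (g x)"] inf by simp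
  \<comment> \<open>\<open>ext_set\<close> is a preimage under the shift, so changing the last
    letter does not leave it.\<close>
  have sib: "snoc (seq_shift z) a \<in> ext_set ?D N" if "z \<in> ext_set ?D N" for z a
    using that by (simp add: ext_set_def)
  have le: "g z \<le> ?r" if "z \<in> ext_set ?D N" for z
    using that by (intro g_le_of_siblings assms(1) ge sib)
  \<comment> \<open>The infimum over the empty set would be infinite, not \<epsilon>. A point of the
    set is needed to see that \<open>?r\<close> is positive.\<close>
  have "ext_set ?D N \<noteq> {}" using inf by (auto simp: top_ereal_def)
  then obtain z where "z \<in> ext_set ?D N" by blast
  then have r: "0 < ?r" using \<epsilon> ge[of z] le[of z] by linarith
  have tail: "(\<lambda>j. x (i + j)) \<in> ?D" if "x \<in> ?D" for x i
  proof (induction i)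
    case 0
    show ?case using that by simp
  next
    case (Suc i)
    then have "seq_shift (\<lambda>j. x (i + j)) \<in> ?D" using inv by blast
    then show ?case by (simp add: seq_shift_def)
  qed
  have "orbit_bound g N ?r x" if x: "x \<in> ?D" for x
    unfolding orbit_bound_def
  proof (intro allI impI le)
    fix i z assume z: "\<forall>j<N. z (Suc j) = x (i + Suc j)"
    \<comment> \<open>Replacing the last letter of \<open>z\<close> by \<open>x i\<close> gives
      agreement with the tail of \<open>x\<close> from \<open>i\<close> in \<open>Suc N\<close>
      letters; that tail is again a discontinuity point.\<close>
    have "snoc (seq_shift z) (x i) \<in> cyl (Suc N) (\<lambda>j. x (i + j))"
      unfolding snoc_in_cyl_Suc using z by (simp add: cyl_def seq_shift_def)
    then have "snoc (seq_shift z) (x i) \<in> cyls (Suc N) ?D"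
      using tail[OF x] unfolding cyls_def by blast
    then show "z \<in> ext_set ?D N" unfolding ext_set_def by (metis image_eqI seq_shift_snoc vimageI)
  qed
  with growth r show ?thesis by (intro g_measure_exists[OF assms(1)])
qed

end
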